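(* Fix an input $x$. Let $p=p_\theta(\cdot\mid x)$ be the model's softmax predictive distribution and $q=q(\cdot\mid x)$ the data conditional distribution over a finite set of $c$ classes, both regarded as probability vectors in $\mathbb{R}^c$. Let $r=q-p$. With $\delta_z=p-e_y$, $B_{q,z}=\mathbb{E}_{y\sim q}[\delta_z\delta_z^\top]$ and $B_{F,z}=\mathbb{E}_{y\sim p}[\delta_z\delta_z^\top]=\operatorname{Diag}(p)-pp^\top$, one has $$B_{q,z}-B_{F,z}=\operatorname{Diag}(r)-pr^\top-rp^\top,\qquad \|B_{q,z}-B_{F,z}\|_2\le 3\|q-p\|_2 .$$ Moreover, if $\delta_l=J_l^\top\delta_z$ where the matrix $J_l$ is independent of $y$, and $B_{q,l}=\mathbb{E}_{y\sim q}[\delta_l\delta_l^\top]$, $B_{F,l}=\mathbb{E}_{y\sim p}[\delta_l\delta_l^\top]$, then $$\|B_{q,l}-B_{F,l}\|_2\le 3\|J_l\|_2^2\,\|q-p\|_2 .$$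
   Context: $e_y$ is the $y$-th standard basis vector of $\mathbb{R}^c$; $\delta_z=p-e_y$ is the gradient of the softmax cross-entropy loss with respect to the logits $z$ when the label is $y$. In the expectations $p$ (and $J_l$) is held fixed and only the label $y$ is random. For matrices $\|\cdot\|_2$ is the spectral norm, for vectors it is the Euclidean norm; $\operatorname{Diag}(v)$ is the diagonal matrix with diagonal $v$. *)

theory Defs
  imports "HOL-Analysis.Analysis" "HOL-Probability.Probability"
begin

text \<open>Classes are the elements of a finite type; logits and probability vectors live in
  \<^typ>\<open>real ^ 'c\<close>.\<close>

definition softmax :: "real ^ 'c \<Rightarrow> real ^ 'c" where
  "softmax z = (\<chi> y. exp (z $ y) / (\<Sum>k\<in>UNIV. exp (z $ k)))"

definition softmax_pmf :: "real ^ 'c \<Rightarrow> 'c pmf" where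
  "softmax_pmf z = embed_pmf (\<lambda>y. softmax z $ y)"

definition prob_vec :: "'c pmf \<Rightarrow> real ^ 'c" where
  "prob_vec P = (\<chi> y. pmf P y)"

lemma sum_exp_pos: "(\<Sum>k\<in>UNIV. exp (z $ k)) > (0::real)" for z :: "real ^ 'c"
  by (intro sum_pos) auto

lemma pmf_softmax_pmf: "pmf (softmax_pmf z) y = softmax z $ y" for z :: "real ^ 'c"
proof -
  have nn: "0 \<le> softmax z $ k" for k
    by (simp add: softmax_def sum_nonneg)
  have "(\<Sum>k\<in>UNIV. softmax z $ k) = 1"
    using sum_exp_pos[of z] by (simp add: softmax_def flip: sum_divide_distrib)
  then have "(\<integral>\<^sup>+k. ennreal (softmax z $ k) \<partial>count_space UNIV) = 1"
    by (simp add: nn_integral_count_space_finite sum_ennreal nn)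
  then show ?thesis
    unfolding softmax_pmf_def by (intro pmf_embed_pmf) (simp_all add: nn)
qed

lemma prob_vec_softmax_pmf: "prob_vec (softmax_pmf z) = softmax z"
  by (simp add: prob_vec_def pmf_softmax_pmf vec_eq_iff)

text \<open>The residual \<open>p - e\<^sub>y\<close>; the lemma confirms that for \<open>p = softmax z\<close> it is the
  gradient of the cross-entropy loss in the logits.\<close>

definition logit_grad :: "real ^ 'c \<Rightarrow> 'c \<Rightarrow> real ^ 'c" where
  "logit_grad p y = p - axis y 1"

lemma cross_entropy_gradient:
  fixes z :: "real ^ 'c" and y :: 'c
  shows "GDERIV (\<lambda>z. - ln (softmax z $ y)) z :> logit_grad (softmax z) y"
proof -
  have eq: "- ln (softmax w $ y) = ln (\<Sum>k\<in>UNIV. exp (w $ k)) - w $ y" for w :: "real ^ 'c"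
    using sum_exp_pos[of w] by (simp add: softmax_def ln_div)
  have "((\<lambda>w. ln (\<Sum>k\<in>UNIV. exp (w $ k)) - w $ y) has_derivative
          (\<lambda>h. (\<Sum>k\<in>UNIV. exp (z $ k) * h $ k) / (\<Sum>k\<in>UNIV. exp (z $ k)) - h $ y)) (at z)"
    using sum_exp_pos[of z]
    by (auto intro!: derivative_eq_intros bounded_linear_imp_has_derivative[OF bounded_linear_vec_nth]
        simp: field_simps)
  moreover have "(\<lambda>h. (\<Sum>k\<in>UNIV. exp (z $ k) * h $ k) / (\<Sum>k\<in>UNIV. exp (z $ k)) - h $ y)
      = (\<lambda>h. h \<bullet> logit_grad (softmax z) y)"
    by (simp add: logit_grad_def softmax_def inner_diff_right inner_axis inner_vec_def[of _ "vec_lambda _"]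
        sum_divide_distrib mult.commute)
  ultimately show ?thesis
    by (simp add: gderiv_def eq)
qed

definition outer_product :: "real ^ 'm \<Rightarrow> real ^ 'n \<Rightarrow> real ^ 'n ^ 'm" where
  "outer_product u v = (\<chi> i j. u $ i * v $ j)"

definition diag_mat :: "real ^ 'n \<Rightarrow> real ^ 'n ^ 'n" where
  "diag_mat v = (\<chi> i j. if i = j then v $ i else 0)"

text \<open>The norm of the type \<^typ>\<open>real ^ 'n ^ 'm\<close> is the Frobenius norm, so the spectral norm
  is taken as the operator norm for the Euclidean vector norms.\<close>

definition spectral_norm :: "real ^ 'n ^ 'm \<Rightarrow> real" where
  "spectral_norm A = onorm (\<lambda>v. A *v v)"

definition second_moment :: "'c pmf \<Rightarrow> ('c \<Rightarrow> real ^ 'n) \<Rightarrow> real ^ 'n ^ 'n" where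
  "second_moment P g = measure_pmf.expectation P (\<lambda>y. outer_product (g y) (g y))"

end

theory Submission
  imports Defs
begin

text \<open>The matrix \<open>\<delta> \<delta>\<^sup>T\<close> with \<open>\<delta> = p - e\<^sub>y\<close> depends on the label only through
  \<open>Diag (e\<^sub>y) - p e\<^sub>y\<^sup>T - e\<^sub>y p\<^sup>T\<close>, which is linear in \<open>e\<^sub>y\<close>. Averaging replaces \<open>e\<^sub>y\<close> by the
  distribution of the label, and a difference of averages replaces it by \<open>r\<close>. Each of the three
  terms has spectral norm at most \<open>norm r\<close>, because a probability vector has Euclidean norm at
  most 1. Pulling back along \<open>J\<close> conjugates the second moments by \<open>J\<close>.\<close>

lemma second_moment_eq_sum:
  fixes P :: "'c::finite pmf"
  shows "second_moment P g = (\<Sum>y\<in>UNIV. pmf P y *\<^sub>R outer_product (g y) (g y))"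
  unfolding second_moment_def by (intro integral_measure_pmf) auto

lemma sum_pmf_UNIV: "(\<Sum>y\<in>UNIV. pmf P y) = 1" for P :: "'c::finite pmf"
  by (intro sum_pmf_eq_1) auto

text \<open>Here \<open>p\<close> is not tied to \<open>Q\<close>, so one formula serves both label
  distributions. The diagonal matrix is the average of
  \<open>outer_product (axis y 1) (axis y 1)\<close>, and \<open>outer_product p p\<close> keeps
  weight 1 because the probabilities sum to 1.\<close>

lemma second_moment_logit_grad:
  "second_moment Q (logit_grad p)
    = diag_mat (prob_vec Q) + outer_product p p
      - outer_product p (prob_vec Q) - outer_product (prob_vec Q) p"
proof -
  have "(\<Sum>y\<in>UNIV. pmf Q y * ((p $ i - axis y 1 $ i) * (p $ j - axis y 1 $ j)))
      = (if i = j then pmf Q i else 0) + p $ i * p $ j - p $ i * pmf Q j - pmf Q i * p $ j" for i j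
  proof -
    \<comment> \<open>Each product with an \<open>axis\<close> entry becomes a conditional testing
      \<open>y\<close> against a fixed index, so the sum over \<open>y\<close> collapses to one
      term.\<close>
    have "(\<Sum>y\<in>UNIV. pmf Q y * ((p $ i - axis y 1 $ i) * (p $ j - axis y 1 $ j)))
        = (\<Sum>y\<in>UNIV. (if y = i then (if i = j then pmf Q i else 0) else 0)
            + pmf Q y * (p $ i * p $ j)
            - (if y = j then p $ i * pmf Q j else 0)
            - (if y = i then pmf Q i * p $ j else 0))"
      by (intro sum.cong refl) (auto simp: axis_def algebra_simps)
    then show ?thesis
      by (simp add: sum.distrib sum_subtractf sum_pmf_UNIV flip: sum_distrib_right)
  qed
  then show ?thesis
    by (simp add: vec_eq_iff second_moment_eq_sum outer_product_def diag_mat_def prob_vec_def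
        logit_grad_def)
qed

lemma outer_product_mult_vec: "outer_product u v *v w = (v \<bullet> w) *\<^sub>R u"
  by (simp add: vec_eq_iff matrix_vector_mult_def outer_product_def inner_vec_def
      sum_distrib_left sum_distrib_right mult_ac)

lemma diag_mat_mult_vec: "diag_mat v *v w = (\<chi> i. v $ i * w $ i)"
  by (simp add: vec_eq_iff matrix_vector_mult_def diag_mat_def if_distrib if_distribR cong: if_cong)

text \<open>Every entry of \<open>v\<close> is at most \<open>norm v\<close> in absolute value, so
  the product is dominated entry by entry by \<open>norm v *\<^sub>R w\<close>.\<close>

lemma norm_diag_mat_mult_vec: "norm (diag_mat v *v w) \<le> norm v * norm w"
proof -
  have "norm (diag_mat v *v w) \<le> norm (norm v *\<^sub>R w)"
    by (rule norm_le_componentwise_cart)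
      (simp add: diag_mat_mult_vec abs_mult mult_right_mono component_le_norm_cart)
  then show ?thesis by simp
qed

lemma norm_prob_vec_le_1: "norm (prob_vec P) \<le> 1"
proof -
  have "norm (prob_vec P) \<le> (\<Sum>i\<in>UNIV. \<bar>prob_vec P $ i\<bar>)"
    by (rule norm_le_l1_cart)
  then show ?thesis by (simp add: prob_vec_def sum_pmf_UNIV)
qed

lemma norm_mult_vec_le_spectral_norm: "norm (A *v w) \<le> spectral_norm A * norm w"
  unfolding spectral_norm_def by (intro onorm matrix_vector_mul_bounded_linear)

lemma spectral_norm_nonneg: "0 \<le> spectral_norm A"
  unfolding spectral_norm_def by (intro onorm_pos_le matrix_vector_mul_bounded_linear)

lemma spectral_norm_le: "(\<And>w. norm (A *v w) \<le> b * norm w) \<Longrightarrow> spectral_norm A \<le> b"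
  unfolding spectral_norm_def by (rule onorm_le)

lemma spectral_norm_mult: "spectral_norm (A ** B) \<le> spectral_norm A * spectral_norm B"
proof (rule spectral_norm_le)
  fix w
  have "norm ((A ** B) *v w) \<le> spectral_norm A * norm (B *v w)"
    by (metis matrix_vector_mul_assoc norm_mult_vec_le_spectral_norm)
  also have "\<dots> \<le> spectral_norm A * (spectral_norm B * norm w)"
    by (intro mult_left_mono norm_mult_vec_le_spectral_norm spectral_norm_nonneg)
  finally show "norm ((A ** B) *v w) \<le> spectral_norm A * spectral_norm B * norm w"
    by (simp add: mult_ac)
qed

text \<open>Moving the transpose across the inner product turns the square of \<open>norm ?u\<close>
  into \<open>w \<bullet> (A *v ?u)\<close>; Cauchy-Schwarz then leaves a factor
  \<open>norm ?u\<close> to cancel.\<close>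

lemma spectral_norm_transpose_le: "spectral_norm (transpose A) \<le> spectral_norm A"
proof (rule spectral_norm_le)
  fix w
  let ?u = "transpose A *v w"
  have "norm ?u * norm ?u = w \<bullet> (A *v ?u)"
    by (metis dot_lmul_matrix norm_eq_square power2_eq_square power2_norm_eq_inner
        transpose_matrix_vector)
  also have "\<dots> \<le> norm w * norm (A *v ?u)"
    by (rule norm_cauchy_schwarz)
  also have "\<dots> \<le> norm w * (spectral_norm A * norm ?u)"
    by (intro mult_left_mono norm_mult_vec_le_spectral_norm) simp
  finally have "norm ?u * norm ?u \<le> (spectral_norm A * norm w) * norm ?u"
    by (simp add: mult_ac)
  then show "norm ?u \<le> spectral_norm A * norm w"
    by (cases "norm ?u = 0") (auto simp: spectral_norm_nonneg)
qed

text \<open>The 3 counts the terms. Cauchy-Schwarz bounds each rank-one term by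
  \<open>norm p * norm r * norm w\<close>, where \<open>norm p\<close> is at most 1.\<close>

lemma spectral_norm_diag_minus_outer_products_le:
  fixes p r :: "real ^ 'n"
  assumes "norm p \<le> 1"
  shows "spectral_norm (diag_mat r - outer_product p r - outer_product r p) \<le> 3 * norm r"
proof (rule spectral_norm_le)
  fix w :: "real ^ 'n"
  have pr: "norm p * (norm r * norm w) \<le> norm r * norm w"
    using assms by (simp add: mult_left_le_one_le)
  have "norm (outer_product p r *v w) \<le> norm r * norm w"
  proof -
    have "norm (outer_product p r *v w) \<le> norm r * norm w * norm p"
      by (simp add: outer_product_mult_vec mult_right_mono Cauchy_Schwarz_ineq2)
    with pr show ?thesis by (simp add: mult_ac)
  qed
  moreover have "norm (outer_product r p *v w) \<le> norm r * norm w"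
  proof -
    have "norm (outer_product r p *v w) \<le> norm p * norm w * norm r"
      by (simp add: outer_product_mult_vec mult_right_mono Cauchy_Schwarz_ineq2)
    with pr show ?thesis by (simp add: mult_ac)
  qed
  moreover have "norm ((diag_mat r - outer_product p r - outer_product r p) *v w)
      \<le> norm (diag_mat r *v w) + norm (outer_product p r *v w) + norm (outer_product r p *v w)"
    by (simp add: matrix_vector_mult_diff_rdistrib order_trans[OF norm_triangle_ineq4]
        norm_triangle_ineq4)
  ultimately show "norm ((diag_mat r - outer_product p r - outer_product r p) *v w)
      \<le> 3 * norm r * norm w"
    using norm_diag_mat_mult_vec[of r w] by linarith
qed

text \<open>Applied to any \<open>w\<close>, both sides are multiples of \<open>A *v u\<close>; the
  coefficients agree because \<open>transpose A\<close> is the adjoint of \<open>A\<close>.\<close>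

lemma outer_product_mult_vec_both:
  "outer_product (A *v u) (A *v u) = A ** outer_product u u ** transpose A"
  by (simp add: matrix_eq outer_product_mult_vec matrix_vector_mult_scaleR
      flip: matrix_vector_mul_assoc) (metis dot_lmul_matrix inner_commute
        transpose_matrix_vector transpose_transpose)

text \<open>Lets conjugation pass through the average over labels and through the difference of two
  second moments.\<close>

lemma linear_matrix_mul_left_right: "linear (\<lambda>M. A ** M ** B)"
  for A :: "real ^ 'n ^ 'm" and B :: "real ^ 'k ^ 'l"
  by (intro linearI) (simp_all add: vec_eq_iff matrix_matrix_mult_def sum.distrib
      sum_distrib_left sum_distrib_right algebra_simps)

lemma second_moment_mult_vec:
  fixes P :: "'c::finite pmf"
  shows "second_moment P (\<lambda>y. A *v g y) = A ** second_moment P g ** transpose A"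
  by (simp add: second_moment_eq_sum outer_product_mult_vec_both
      linear_sum[OF linear_matrix_mul_left_right] linear_cmul[OF linear_matrix_mul_left_right])

theorem proposition3:
  fixes logits :: "'t \<Rightarrow> 'x \<Rightarrow> real ^ 'c" and \<theta> :: 't and x :: 'x
    and q_data :: "'x \<Rightarrow> 'c pmf"
    and P Q :: "'c pmf"
    and p q r :: "real ^ 'c"
    and \<delta>z :: "'c \<Rightarrow> real ^ 'c"
    and Bqz BFz :: "real ^ 'c ^ 'c"
    and Jl :: "real ^ 'd ^ 'c"
    and \<delta>l :: "'c \<Rightarrow> real ^ 'd"
    and Bql BFl :: "real ^ 'd ^ 'd"
  assumes "P = softmax_pmf (logits \<theta> x)" and "Q = q_data x"
    and "p = prob_vec P" and "q = prob_vec Q" and "r = q - p"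
    and "\<And>y. \<delta>z y = logit_grad p y"
    and "Bqz = second_moment Q \<delta>z" and "BFz = second_moment P \<delta>z"
    and "\<And>y. \<delta>l y = transpose Jl *v \<delta>z y"
    and "Bql = second_moment Q \<delta>l" and "BFl = second_moment P \<delta>l"
  shows "BFz = diag_mat p - outer_product p p
    \<and> Bqz - BFz = diag_mat r - outer_product p r - outer_product r p
    \<and> spectral_norm (Bqz - BFz) \<le> 3 * norm (q - p)
    \<and> spectral_norm (Bql - BFl) \<le> 3 * (spectral_norm Jl)\<^sup>2 * norm (q - p)"
proof -
  have \<delta>z: "\<delta>z = logit_grad p" and \<delta>l: "\<delta>l = (\<lambda>y. transpose Jl *v \<delta>z y)"
    using assms by auto
  have BFz: "BFz = diag_mat p - outer_product p p"
    using assms by (simp add: \<delta>z second_moment_logit_grad)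
  \<comment> \<open>Subtracting \<open>BFz\<close> leaves \<open>outer_product p p\<close> twice;
    each copy turns \<open>q\<close> into \<open>r\<close> in one of the mixed outer
    products.\<close>
  have diff: "Bqz - BFz = diag_mat r - outer_product p r - outer_product r p"
    unfolding BFz assms(7) \<delta>z second_moment_logit_grad assms(5) assms(4)[symmetric]
    by (simp add: vec_eq_iff diag_mat_def outer_product_def algebra_simps)
  have bound: "spectral_norm (Bqz - BFz) \<le> 3 * norm (q - p)"
    unfolding diff assms(5)[symmetric]
    by (intro spectral_norm_diag_minus_outer_products_le) (simp add: assms(3) norm_prob_vec_le_1)
  have "Bql - BFl = transpose Jl ** (Bqz - BFz) ** Jl"
    by (simp only: assms(7,8,10,11) \<delta>l second_moment_mult_vec transpose_transpose
        linear_diff[OF linear_matrix_mul_left_right])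
  then have "spectral_norm (Bql - BFl)
      \<le> spectral_norm (transpose Jl ** (Bqz - BFz)) * spectral_norm Jl"
    by (simp add: spectral_norm_mult)
  also have "\<dots> \<le> spectral_norm (transpose Jl) * spectral_norm (Bqz - BFz) * spectral_norm Jl"
    by (intro mult_right_mono spectral_norm_mult spectral_norm_nonneg)
  \<comment> \<open>Bounding the norm of \<open>transpose Jl\<close> by that of \<open>Jl\<close>
    produces the square.\<close>
  also have "\<dots> \<le> spectral_norm Jl * (3 * norm (q - p)) * spectral_norm Jl"
    by (intro mult_right_mono mult_mono spectral_norm_transpose_le bound spectral_norm_nonneg)
  finally have "spectral_norm (Bql - BFl) \<le> 3 * (spectral_norm Jl)\<^sup>2 * norm (q - p)"
    by (simp add: power2_eq_square mult_ac)
  with BFz diff bound show ?thesis by blast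
qed

end
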